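(* For every positive integer $n$, the general position number of the $n$-dimensional integer lattice graph $P_\infty^n$ equals $2^{2^{n-1}}$, i.e. ${\rm gp}(P_\infty^n) = 2^{2^{n-1}}$.
   Context: For a connected graph $G$ with shortest-path distance $d_G$, a set $S\subseteq V(G)$ is a general position set if $d_G(u,v)\neq d_G(u,w)+d_G(w,v)$ for every three pairwise distinct vertices $u,v,w\in S$ (i.e. no three vertices of $S$ lie on a common geodesic). The general position number ${\rm gp}(G)$ is the maximum cardinality of a general position set of $G$. $P_\infty$ is the two-way infinite path with vertex set $\mathbb{Z}$, where $u,v$ are adjacent iff $|u-v|=1$. $P_\infty^n$ is the Cartesian product of $n$ copies of $P_\infty$: vertex set $\mathbb{Z}^n$, two vertices adjacent iff they differ in exactly one coordinate and by exactly $1$ there. Equivalently, the distance is $d(u,v)=\sum_{i=1}^n |u_i-v_i|$. *)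

theory Defs
  imports "Graph_Theory.Graph_Theory" "HOL-Library.Extended_Nat" "HOL-Library.FuncSet"
begin

text \<open>
  Undirected graphs are symmetric loop-free digraphs \<^locale>\<open>pair_bidirected_digraph\<close>: an edge
  is the pair of its two orientations. The graph distance is the library's shortest-path cost
  for unit weights. It takes values in \<^typ>\<open>ereal\<close>, with \<open>\<infinity>\<close> for vertices in different components.
\<close>

definition graph_dist :: "'a pair_pre_digraph \<Rightarrow> 'a \<Rightarrow> 'a \<Rightarrow> ereal" where
  "graph_dist G u v = wf_digraph.\<mu> (with_proj G) (\<lambda>_. 1) u v"

definition general_position_set :: "'a pair_pre_digraph \<Rightarrow> 'a set \<Rightarrow> bool" where
  "general_position_set G S \<longleftrightarrow> S \<subseteq> pverts G \<and>
     (\<forall>u\<in>S. \<forall>v\<in>S. \<forall>w\<in>S. u \<noteq> v \<and> u \<noteq> w \<and> v \<noteq> w \<longrightarrow>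
        graph_dist G u v \<noteq> graph_dist G u w + graph_dist G w v)"

text \<open>
  The supremum is over a nonempty set (the empty set is in general position), so a finite value
  of \<open>gp_number G\<close> is attained and hence the maximum. Infinite sets count as \<open>\<infinity>\<close> here, whereas
  \<^const>\<open>card\<close> would make them \<open>0\<close>.
\<close>

definition gp_number :: "'a pair_pre_digraph \<Rightarrow> enat" where
  "gp_number G =
     (SUP S\<in>{S. general_position_set G S}. if finite S then enat (card S) else \<infinity>)"

definition infinite_path :: "int pair_pre_digraph" where
  "infinite_path = \<lparr>pverts = UNIV, parcs = {(u, v). \<bar>u - v\<bar> = 1}\<rparr>"

definition cartesian_power :: "'a pair_pre_digraph \<Rightarrow> nat \<Rightarrow> (nat \<Rightarrow> 'a) pair_pre_digraph" where
  "cartesian_power G n =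
     \<lparr>pverts = {..<n} \<rightarrow>\<^sub>E pverts G,
      parcs = {(u, v). u \<in> {..<n} \<rightarrow>\<^sub>E pverts G \<and> v \<in> {..<n} \<rightarrow>\<^sub>E pverts G \<and>
        (\<exists>i<n. (u i, v i) \<in> parcs G \<and> (\<forall>j<n. j \<noteq> i \<longrightarrow> u j = v j))}\<rparr>"

lemma infinite_path_bidirected: "pair_bidirected_digraph infinite_path"
  by unfold_locales
    (auto simp: infinite_path_def symmetric_def arcs_ends_def arc_to_ends_def sym_def)

lemma cartesian_power_bidirected:
  assumes "pair_bidirected_digraph G"
  shows "pair_bidirected_digraph (cartesian_power G n)"
proof -
  interpret pair_bidirected_digraph G by fact
  have s: "(b, a) \<in> parcs G" if "(a, b) \<in> parcs G" for a b
    using pair_sym_arcs that by (auto simp: symmetric_def sym_def)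
  show ?thesis
  proof unfold_locales
    show "symmetric (with_proj (cartesian_power G n))"
      unfolding symmetric_def
      by (rule symI) (auto simp: cartesian_power_def intro: s)
  next
    show "fst e \<noteq> snd e" if "e \<in> parcs (cartesian_power G n)" for e
      using that pair_no_loops by (fastforce simp: cartesian_power_def)
  next
    show "fst e \<in> pverts (cartesian_power G n)" if "e \<in> parcs (cartesian_power G n)" for e
      using that by (cases e) (simp add: cartesian_power_def)
    show "snd e \<in> pverts (cartesian_power G n)" if "e \<in> parcs (cartesian_power G n)" for e
      using that by (cases e) (simp add: cartesian_power_def)
  qed
qed

text \<open>The distance in the lattice graph is the \<open>\<ell>\<^sub>1\<close> distance, so all distances are finite.\<close>

lemma graph_dist_lattice:
  assumes u: "u \<in> {..<n} \<rightarrow>\<^sub>E UNIV" and v: "v \<in> {..<n} \<rightarrow>\<^sub>E UNIV"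
  shows "graph_dist (cartesian_power infinite_path n) u v
    = ereal (real_of_int (\<Sum>i<n. \<bar>u i - v i\<bar>))"
proof -
  let ?G = "cartesian_power infinite_path n"
  interpret pair_bidirected_digraph ?G
    by (intro cartesian_power_bidirected infinite_path_bidirected)
  have verts: "pverts ?G = {..<n} \<rightarrow>\<^sub>E UNIV"
    by (simp add: cartesian_power_def infinite_path_def)
  have arc: "(a, b) \<in> parcs ?G \<longleftrightarrow> a \<in> {..<n} \<rightarrow>\<^sub>E UNIV \<and> b \<in> {..<n} \<rightarrow>\<^sub>E UNIV \<and>
      (\<exists>i<n. \<bar>a i - b i\<bar> = 1 \<and> (\<forall>j<n. j \<noteq> i \<longrightarrow> a j = b j))" for a b
    by (simp add: cartesian_power_def infinite_path_def)
  have cost: "awalk_cost (\<lambda>_. 1) p = real (length p)" for p :: "((nat \<Rightarrow> int) \<times> (nat \<Rightarrow> int)) list"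
    by (induction p) auto
  have step: "(\<Sum>i<n. \<bar>a i - b i\<bar>) = 1" if ab: "(a, b) \<in> parcs ?G" for a b
  proof -
    obtain i where i: "i < n" "\<bar>a i - b i\<bar> = 1" "\<forall>j<n. j \<noteq> i \<longrightarrow> a j = b j"
      using ab arc[of a b] by blast
    have "(\<Sum>j<n. \<bar>a j - b j\<bar>) = \<bar>a i - b i\<bar> + (\<Sum>j\<in>{..<n} - {i}. \<bar>a j - b j\<bar>)"
      using i(1) by (intro sum.remove) auto
    also have "(\<Sum>j\<in>{..<n} - {i}. \<bar>a j - b j\<bar>) = 0"
      using i(3) by (intro sum.neutral) auto
    finally show ?thesis using i(2) by simp
  qed
  have low: "(\<Sum>i<n. \<bar>a i - v i\<bar>) \<le> int (length p)" if "awalk a p v" for a p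
    using that
  proof (induction p arbitrary: a)
    case Nil
    then show ?case by (simp add: awalk_Nil_iff)
  next
    case (Cons e p)
    obtain b where e: "e = (a, b)" "(a, b) \<in> parcs ?G" "awalk b p v"
      using Cons.prems by (cases e) (auto simp: awalk_Cons_iff)
    have "(\<Sum>i<n. \<bar>a i - v i\<bar>) \<le> (\<Sum>i<n. \<bar>a i - b i\<bar> + \<bar>b i - v i\<bar>)"
      by (intro sum_mono) auto
    then show ?case using step[OF e(2)] Cons.IH[OF e(3)] by (simp add: sum.distrib)
  qed
  have up: "\<exists>p. awalk a p v \<and> length p = k"
    if "a \<in> {..<n} \<rightarrow>\<^sub>E UNIV" "(\<Sum>i<n. \<bar>a i - v i\<bar>) = int k" for a k
    using that
  proof (induction k arbitrary: a)
    case 0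
    have "a i = v i" if "i < n" for i
      using 0(2) that by (simp add: sum_nonneg_eq_0_iff)
    then have "a = v" using 0(1) v by (intro PiE_ext) auto
    then show ?case using v verts by (intro exI[of _ "[]"]) (simp add: awalk_Nil_iff)
  next
    case (Suc k)
    have "(\<Sum>i<n. \<bar>a i - v i\<bar>) \<noteq> 0" using Suc.prems(2) by simp
    then have "\<not> (\<forall>i<n. a i = v i)" by (auto dest: sum.not_neutral_contains_not_neutral)
    then obtain i where i: "i < n" "a i \<noteq> v i" by auto
    define b where "b = a(i := a i + sgn (v i - a i))"
    have bi: "\<bar>b i - v i\<bar> = \<bar>a i - v i\<bar> - 1"
      using i(2) by (auto simp: b_def sgn_if)
    have bV: "b \<in> {..<n} \<rightarrow>\<^sub>E UNIV"
      using Suc.prems(1) i(1) by (auto simp: b_def PiE_iff extensional_def)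
    have ab: "(a, b) \<in> parcs ?G"
      unfolding arc using Suc.prems(1) bV i
      by (auto simp: b_def sgn_if intro!: exI[of _ i])
    have "(\<Sum>j<n. \<bar>b j - v j\<bar>) = \<bar>b i - v i\<bar> + (\<Sum>j\<in>{..<n} - {i}. \<bar>b j - v j\<bar>)"
      using i(1) by (intro sum.remove) auto
    also have "(\<Sum>j\<in>{..<n} - {i}. \<bar>b j - v j\<bar>) = (\<Sum>j\<in>{..<n} - {i}. \<bar>a j - v j\<bar>)"
      by (intro sum.cong) (auto simp: b_def)
    also have "\<bar>b i - v i\<bar> + \<dots> = (\<Sum>j<n. \<bar>a j - v j\<bar>) - 1"
      using i(1) bi by (simp add: sum.remove[of _ i])
    finally have "(\<Sum>j<n. \<bar>b j - v j\<bar>) = int k" using Suc.prems(2) by simp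
    from Suc.IH[OF bV this] obtain p where p: "awalk b p v" "length p = k" by blast
    then show ?case using ab by (intro exI[of _ "(a, b) # p"]) (auto simp: awalk_Cons_iff)
  qed
  define k where "k = nat (\<Sum>i<n. \<bar>u i - v i\<bar>)"
  have k: "(\<Sum>i<n. \<bar>u i - v i\<bar>) = int k" by (simp add: k_def sum_nonneg)
  obtain p where p: "awalk u p v" "length p = k" using up[OF u k] by blast
  have "(INF q\<in>{q. awalk u q v}. ereal (awalk_cost (\<lambda>_. 1) q)) = ereal (real k)"
  proof (rule antisym)
    show "(INF q\<in>{q. awalk u q v}. ereal (awalk_cost (\<lambda>_. 1) q)) \<le> ereal (real k)"
      using p by (intro INF_lower2[of p]) (auto simp: cost)
    show "ereal (real k) \<le> (INF q\<in>{q. awalk u q v}. ereal (awalk_cost (\<lambda>_. 1) q))"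
      using low k by (intro INF_greatest) (fastforce simp: cost)
  qed
  then show ?thesis by (simp add: graph_dist_def \<mu>_def k)
qed

end

theory Submission
  imports Defs
begin

text \<open>
  A vertex \<open>w\<close> lies on a geodesic from \<open>u\<close> to \<open>v\<close> iff it lies between them in every coordinate.
  A set \<open>T\<close> of coordinates other than \<open>0\<close> determines the product order in which the coordinates
  in \<open>T\<close> are reversed. Any two vertices are comparable in one of these \<open>2\<^bsup>n - 1\<^esup>\<close> orders, and a
  set is in general position iff none of the orders has a chain of three of its elements.

  Upper bound: label each vertex of \<open>S\<close> by the orders in which it is not minimal in \<open>S\<close>.
  If \<open>x\<close> precedes \<open>y\<close> in the order \<open>T\<close>, then \<open>T\<close> is in the label of \<open>y\<close> but not in that of \<open>x\<close>,
  as there is no chain of three. So the labels are distinct, and there are \<open>2^(2^(n - 1))\<close> of them.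

  Lower bound: enumerate the orders as \<open>h 0, h 1, \<dots>\<close> and send a set \<open>A\<close> of indices to the vertex
  whose coordinate \<open>i\<close> is \<open>\<Sum>k\<in>A. \<plusminus>2\<^sup>k\<close>, with a minus sign iff \<open>i \<in> h k\<close>. The largest index in
  which two sets differ then determines the order in which their vertices are comparable,
  and which of the two is smaller.
\<close>

definition coord_between :: "nat \<Rightarrow> (nat \<Rightarrow> int) \<Rightarrow> (nat \<Rightarrow> int) \<Rightarrow> (nat \<Rightarrow> int) \<Rightarrow> bool" where
  "coord_between n u w v \<longleftrightarrow> (\<forall>i<n. u i \<le> w i \<and> w i \<le> v i \<or> v i \<le> w i \<and> w i \<le> u i)"

text \<open>The triangle inequality holds in each coordinate separately, so equality of the sums
  forces equality in every coordinate.\<close>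

lemma l1_geodesic_iff_coord_between:
  "(\<Sum>i<n. \<bar>u i - v i\<bar>) = (\<Sum>i<n. \<bar>u i - w i\<bar>) + (\<Sum>i<n. \<bar>w i - v i\<bar>) \<longleftrightarrow> coord_between n u w v"
proof -
  have "(\<Sum>i<n. \<bar>u i - v i\<bar>) = (\<Sum>i<n. \<bar>u i - w i\<bar>) + (\<Sum>i<n. \<bar>w i - v i\<bar>) \<longleftrightarrow>
      (\<Sum>i<n. \<bar>u i - w i\<bar> + \<bar>w i - v i\<bar> - \<bar>u i - v i\<bar>) = 0"
    by (auto simp: sum.distrib sum_subtractf)
  also have "\<dots> \<longleftrightarrow> (\<forall>i<n. \<bar>u i - w i\<bar> + \<bar>w i - v i\<bar> - \<bar>u i - v i\<bar> = 0)"
    by (subst sum_nonneg_eq_0_iff) auto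
  also have "\<dots> \<longleftrightarrow> coord_between n u w v"
  proof -
    have "\<bar>a - c\<bar> + \<bar>c - b\<bar> - \<bar>a - b\<bar> = 0 \<longleftrightarrow> a \<le> c \<and> c \<le> b \<or> b \<le> c \<and> c \<le> a" for a b c :: int
      by (auto simp: abs_if)
    then show ?thesis
      unfolding coord_between_def by simp
  qed
  finally show ?thesis .
qed

lemma general_position_set_lattice_iff:
  "general_position_set (cartesian_power infinite_path n) S \<longleftrightarrow>
     S \<subseteq> ({..<n} \<rightarrow>\<^sub>E UNIV) \<and>
     (\<forall>u\<in>S. \<forall>v\<in>S. \<forall>w\<in>S. u \<noteq> v \<and> u \<noteq> w \<and> v \<noteq> w \<longrightarrow> \<not> coord_between n u w v)"
proof -
  let ?G = "cartesian_power infinite_path n"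
  have dist: "graph_dist ?G u v = graph_dist ?G u w + graph_dist ?G w v \<longleftrightarrow> coord_between n u w v"
    if "u \<in> {..<n} \<rightarrow>\<^sub>E UNIV" "v \<in> {..<n} \<rightarrow>\<^sub>E UNIV" "w \<in> {..<n} \<rightarrow>\<^sub>E UNIV" for u v w
    unfolding l1_geodesic_iff_coord_between[symmetric] graph_dist_lattice[OF that(1,2)]
      graph_dist_lattice[OF that(1,3)] graph_dist_lattice[OF that(3,2)] plus_ereal.simps
      ereal.inject of_int_add[symmetric] of_int_eq_iff ..
  have "pverts ?G = {..<n} \<rightarrow>\<^sub>E UNIV"
    by (simp add: cartesian_power_def infinite_path_def)
  with dist show ?thesis
    unfolding general_position_set_def by (auto simp: subset_iff)
qed

definition flipped_le :: "nat \<Rightarrow> nat set \<Rightarrow> (nat \<Rightarrow> int) \<Rightarrow> (nat \<Rightarrow> int) \<Rightarrow> bool" where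
  "flipped_le n T x y \<longleftrightarrow> (\<forall>i<n. if i \<in> T then y i \<le> x i else x i \<le> y i)"

lemma flipped_le_antisym:
  assumes "flipped_le n T x y" "flipped_le n T y x"
    and "x \<in> {..<n} \<rightarrow>\<^sub>E UNIV" "y \<in> {..<n} \<rightarrow>\<^sub>E UNIV"
  shows "x = y"
  using assms(3,4)
proof (rule PiE_ext)
  fix i assume "i \<in> {..<n}"
  with assms(1,2) show "x i = y i"
    unfolding flipped_le_def by (metis lessThan_iff order_antisym)
qed

lemma coord_between_if_flipped_le:
  "flipped_le n T u w \<Longrightarrow> flipped_le n T w v \<Longrightarrow> coord_between n u w v"
  unfolding flipped_le_def coord_between_def by metis

text \<open>Reverse exactly the coordinates in which \<open>y\<close> lies below \<open>x\<close>;
  by assumption coordinate 0 is not one of them. Complementary sets of reversed coordinates give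
  dual orders, so fixing the direction of coordinate 0 keeps one order of each dual pair.\<close>

lemma flipped_le_exists:
  assumes "x 0 \<le> y 0"
  obtains T where "T \<subseteq> {1..<n}" "flipped_le n T x y"
proof
  show "{i \<in> {1..<n}. y i < x i} \<subseteq> {1..<n}" by auto
  have "x i \<le> y i" if "i < n" "i \<notin> {i \<in> {1..<n}. y i < x i}" for i
    using assms that by (cases i) auto
  then show "flipped_le n {i \<in> {1..<n}. y i < x i} x y"
    unfolding flipped_le_def by auto
qed

lemma general_position_set_lattice_card_le:
  assumes S: "general_position_set (cartesian_power infinite_path n) S"
  shows "finite S \<and> card S \<le> 2 ^ (2 ^ (n - 1))"
proof -
  define label where "label x = {T \<in> Pow {1..<n}. \<exists>y\<in>S. y \<noteq> x \<and> flipped_le n T y x}" for x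
  have sub: "S \<subseteq> {..<n} \<rightarrow>\<^sub>E UNIV"
    using S unfolding general_position_set_lattice_iff by blast
  have no_chain: "\<not> coord_between n u w v"
    if "u \<in> S" "v \<in> S" "w \<in> S" "u \<noteq> v" "u \<noteq> w" "v \<noteq> w" for u v w
    using S that unfolding general_position_set_lattice_iff by blast
  have distinct: "label x \<noteq> label y" if xy: "x \<in> S" "y \<in> S" "x \<noteq> y" "x 0 \<le> y 0" for x y
  proof
    assume eq: "label x = label y"
    obtain T where T: "T \<subseteq> {1..<n}" "flipped_le n T x y"
      using flipped_le_exists[of x y n] xy by blast
    then have "T \<in> label y"
      using xy by (auto simp: label_def)
    then obtain z where z: "z \<in> S" "z \<noteq> x" "flipped_le n T z x"
      unfolding eq[symmetric] by (auto simp: label_def)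
    \<comment> \<open>If \<open>z\<close> were \<open>y\<close>, antisymmetry of the order
      \<open>T\<close> would give \<open>x = y\<close>.\<close>
    have "z \<noteq> y"
      using flipped_le_antisym[OF T(2)] z(3) xy(1-3) sub by (auto simp: subset_iff)
    then show False
      using no_chain[of z y x] coord_between_if_flipped_le[OF z(3) T(2)] z xy by blast
  qed
  have inj: "inj_on label S"
    by (rule inj_onI) (metis distinct linear)
  have range: "label ` S \<subseteq> Pow (Pow {1..<n})"
    by (auto simp: label_def)
  have "finite S"
    using inj range by (meson finite_Pow_iff finite_atLeastLessThan inj_on_finite)
  moreover have "card S \<le> card (Pow (Pow {1..<n}))"
    using inj range by (intro card_inj_on_le) auto
  ultimately show ?thesis
    by (simp add: card_Pow)
qed

text \<open>The leading term has absolute value \<open>2 ^ k\<close>, and the terms below it sum to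
  less than that in absolute value.\<close>

lemma sgn_signed_binary_sum:
  fixes c :: "nat \<Rightarrow> int"
  assumes "k < m" "c k \<noteq> 0" "\<And>j. \<bar>c j\<bar> \<le> 1" "\<And>j. k < j \<Longrightarrow> j < m \<Longrightarrow> c j = 0"
  shows "sgn (\<Sum>j<m. c j * 2 ^ j) = c k"
proof -
  have low: "\<bar>\<Sum>j<l. c j * 2 ^ j\<bar> < 2 ^ l" for l
  proof (induction l)
    case (Suc l)
    have "\<bar>c l * 2 ^ l\<bar> \<le> 1 * 2 ^ l"
      unfolding abs_mult using assms(3)[of l] by (intro mult_mono) auto
    with Suc show ?case
      unfolding sum.lessThan_Suc power_Suc by linarith
  qed simp
  have "(\<Sum>j<m. c j * 2 ^ j) = (\<Sum>j<Suc k. c j * 2 ^ j)"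
    using assms(1,4) by (intro sum.mono_neutral_right) auto
  moreover have "c k = 1 \<or> c k = -1"
    using assms(2) assms(3)[of k] by linarith
  ultimately show ?thesis
    using low[of k] by (auto simp: sgn_if)
qed

definition lex_point :: "nat \<Rightarrow> nat \<Rightarrow> (nat \<Rightarrow> nat set) \<Rightarrow> nat set \<Rightarrow> nat \<Rightarrow> int" where
  "lex_point n m h A =
     (\<lambda>i\<in>{..<n}. \<Sum>k<m. (if i \<in> h k then -1 else 1) * of_bool (k \<in> A) * 2 ^ k)"

text \<open>The index \<open>k\<close> is the largest element of the symmetric difference, so one
  \<open>k\<close> serves all coordinates at once.\<close>

lemma sgn_lex_point_diff:
  assumes "A \<subseteq> {..<m}" "B \<subseteq> {..<m}" "A \<noteq> B"
  obtains k where "k < m" "k \<in> A \<longleftrightarrow> k \<notin> B"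
    "\<forall>i<n. sgn (lex_point n m h A i - lex_point n m h B i) =
       (if i \<in> h k then -1 else 1) * (if k \<in> A then 1 else -1)"
proof -
  define D where "D = (A - B) \<union> (B - A)"
  have D: "finite D" "D \<noteq> {}"
    using assms finite_subset[OF assms(1)] finite_subset[OF assms(2)] by (auto simp: D_def)
  define k where "k = Max D"
  have k: "k \<in> D"
    unfolding k_def using D by (rule Max_in)
  have above: "j \<in> A \<longleftrightarrow> j \<in> B" if "k < j" for j
    using Max_ge[OF D(1), of j] that by (auto simp: k_def D_def)
  have "sgn (lex_point n m h A i - lex_point n m h B i) =
      (if i \<in> h k then -1 else 1) * (if k \<in> A then 1 else -1)" if "i < n" for i
  proof -
    \<comment> \<open>The signed binary digits of the difference in coordinate \<open>i\<close>:
      each is -1, 0 or 1, and all above \<open>k\<close> vanish.\<close>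
    define c :: "nat \<Rightarrow> int"
      where "c j = (if i \<in> h j then -1 else 1) * (of_bool (j \<in> A) - of_bool (j \<in> B))" for j
    have "lex_point n m h A i - lex_point n m h B i = (\<Sum>j<m. c j * 2 ^ j)"
      using that unfolding lex_point_def c_def
      by (simp only: restrict_apply' lessThan_iff flip: sum_subtractf)
        (simp add: left_diff_distrib right_diff_distrib)
    moreover have "sgn (\<Sum>j<m. c j * 2 ^ j) = c k"
      using k assms(1,2) above by (intro sgn_signed_binary_sum) (auto simp: c_def D_def)
    ultimately show ?thesis
      using k by (auto simp: c_def D_def)
  qed
  then show thesis
    using that[of k] k assms(1,2) by (auto simp: D_def)
qed

lemma inj_on_lex_point:
  assumes "n \<ge> 1"
  shows "inj_on (lex_point n m h) (Pow {..<m})"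
proof (rule inj_onI, rule ccontr)
  fix A B assume "A \<in> Pow {..<m}" "B \<in> Pow {..<m}" and neq: "A \<noteq> B"
    and eq: "lex_point n m h A = lex_point n m h B"
  then have "A \<subseteq> {..<m}" "B \<subseteq> {..<m}" by auto
  then obtain k where "k < m" "k \<in> A \<longleftrightarrow> k \<notin> B"
    and sgn: "\<forall>i<n. sgn (lex_point n m h A i - lex_point n m h B i) =
      (if i \<in> h k then -1 else 1) * (if k \<in> A then 1 else -1)"
    using neq by (rule sgn_lex_point_diff)
  show False
    using sgn[rule_format, of 0] eq assms by (auto split: if_splits)
qed

text \<open>If the point of \<open>C\<close> were between those of \<open>A\<close> and
  \<open>B\<close>, the steps from \<open>A\<close> to \<open>C\<close> and from \<open>C\<close> to
  \<open>B\<close> would have equal signs in every coordinate. These signs determine the order,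
  hence by injectivity of \<open>h\<close> the deciding index, and also the direction of each
  step.\<close>

lemma general_position_set_lex_points:
  assumes "n \<ge> 1" and h: "inj_on h {..<m}" "\<And>k. k < m \<Longrightarrow> h k \<subseteq> {1..<n}"
  shows "general_position_set (cartesian_power infinite_path n) (lex_point n m h ` Pow {..<m})"
proof -
  let ?x = "lex_point n m h"
  have "\<not> coord_between n (?x A) (?x C) (?x B)"
    if ABC: "A \<subseteq> {..<m}" "B \<subseteq> {..<m}" "C \<subseteq> {..<m}" "A \<noteq> C" "C \<noteq> B" for A B C
  proof
    assume btw: "coord_between n (?x A) (?x C) (?x B)"
    obtain k where k: "k < m" "k \<in> A \<longleftrightarrow> k \<notin> C" "\<forall>i<n. sgn (?x A i - ?x C i) =
        (if i \<in> h k then -1 else 1) * (if k \<in> A then 1 else -1)"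
      using ABC(1,3,4) by (rule sgn_lex_point_diff)
    obtain l where l: "l < m" "l \<in> C \<longleftrightarrow> l \<notin> B" "\<forall>i<n. sgn (?x C i - ?x B i) =
        (if i \<in> h l then -1 else 1) * (if l \<in> C then 1 else -1)"
      using ABC(3,2,5) by (rule sgn_lex_point_diff)
    have same: "(if i \<in> h k then -1 else 1) * (if k \<in> A then 1 else -1) =
        (if i \<in> h l then -1 else 1) * (if l \<in> C then 1 else (-1::int))" if "i < n" for i
    proof -
      \<comment> \<open>Betweenness gives only weak inequalities; as neither difference vanishes,
        they become strict and the signs agree.\<close>
      have "?x A i - ?x C i \<noteq> 0" "?x C i - ?x B i \<noteq> 0"
        using k(3)[rule_format, OF that] l(3)[rule_format, OF that] by (auto split: if_splits)
      then have "sgn (?x A i - ?x C i) = sgn (?x C i - ?x B i)"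
        using btw that unfolding coord_between_def by (fastforce simp: sgn_if)
      with k(3)[rule_format, OF that] l(3)[rule_format, OF that] show ?thesis by simp
    qed
    \<comment> \<open>Coordinate 0 is never reversed, so its sign gives the direction alone; the
      other coordinates then reveal \<open>h k\<close> and \<open>h l\<close>.\<close>
    have "0 \<notin> h k" "0 \<notin> h l"
      using h(2) k(1) l(1) by fastforce+
    with same[of 0] \<open>n \<ge> 1\<close> have kl: "k \<in> A \<longleftrightarrow> l \<in> C"
      by (auto split: if_splits)
    have "i \<in> h k \<longleftrightarrow> i \<in> h l" if "i < n" for i
      using same[OF that] kl by (auto split: if_splits)
    then have "h k = h l"
      using h(2)[OF k(1)] h(2)[OF l(1)] by (auto simp: subset_iff)
    then have "k = l"
      using h(1) k(1) l(1) by (auto dest: inj_onD)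
    \<comment> \<open>With \<open>k = l\<close>, \<open>kl\<close> puts \<open>k\<close> in both or
      neither of \<open>A\<close> and \<open>C\<close>, although they differ at
      \<open>k\<close>.\<close>
    with kl k(2) show False by blast
  qed
  moreover have "?x A \<in> {..<n} \<rightarrow>\<^sub>E UNIV" for A
    by (simp add: lex_point_def)
  ultimately show ?thesis
    unfolding general_position_set_lattice_iff by (intro conjI) blast+
qed

theorem theorem1:
  fixes n :: nat
  assumes "n \<ge> 1"
  shows "gp_number (cartesian_power infinite_path n) = enat (2 ^ (2 ^ (n - 1)))"
proof (rule antisym)
  let ?G = "cartesian_power infinite_path n"
  \<comment> \<open>The finiteness part of the upper bound excludes the value \<infinity>
    here.\<close>
  show "gp_number ?G \<le> enat (2 ^ (2 ^ (n - 1)))"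
    unfolding gp_number_def
    by (rule SUP_least) (use general_position_set_lattice_card_le in auto)
  define m :: nat where "m = 2 ^ (n - 1)"
  have "card (Pow {1..<n}) = m"
    by (simp add: card_Pow m_def)
  then obtain h where h: "bij_betw h {..<m} (Pow {1..<n})"
    using ex_bij_betw_nat_finite[of "Pow {1..<n}"] by (auto simp: atLeast0LessThan)
  let ?S = "lex_point n m h ` Pow {..<m}"
  have "general_position_set ?G ?S"
    using assms h by (intro general_position_set_lex_points) (auto simp: bij_betw_def)
  moreover have "card ?S = 2 ^ (2 ^ (n - 1))"
    using inj_on_lex_point[OF assms] by (simp add: card_image card_Pow m_def)
  ultimately show "enat (2 ^ (2 ^ (n - 1))) \<le> gp_number ?G"
    unfolding gp_number_def by (intro SUP_upper2[of ?S]) auto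
qed

end
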